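(* Let $\bar p\in\mathrm{int}\,Y_+$ and $\bar x\in D(\bar p)\setminus\{0\}$ be such that $D(\bar p)\ne\emptyset$, $X_+$ is SNC at $\bar x$, and $\widehat\partial u(\bar x)\neq\emptyset$. The following assertions hold: (i) If $\langle\bar p,\bar x\rangle=1$, then $$\widehat\partial(-v)(\bar p)\subset\bigcap_{x^*\in-\widehat\partial u(\bar x)}\{\lambda\bar x:\ \lambda\ge0,\ x^*+\lambda\bar p\in-N(\bar x;X_+)\}.$$ (ii) If $\langle\bar p,\bar x\rangle<1$, then $\widehat\partial(-v)(\bar p)\subset\{0\}$. (iii) If $\langle\bar p,\bar x\rangle<1$ and $\widehat\partial u(\bar x)\setminus N(\bar x;X_+)\ne\emptyset$, then $\widehat\partial(-v)(\bar p)=\emptyset$. (iv) If $u$ is Fréchet differentiable at $\bar x$, and the map $D:\mathrm{dom}\,B\rightrightarrows X_+$ admits a local upper Lipschitzian selection at $(\bar p,\bar x)$, then $$\widehat\partial(-v)(\bar p)=\begin{cases}\{\langle\nabla u(\bar x),\bar x\rangle\,\bar x\}&\text{if }\langle\bar p,\bar x\rangle=1,\\ \{0\}&\text{if }\langle\bar p,\bar x\rangle<1.\end{cases}$$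
   Context: $X$ is a real reflexive Banach space with dual $X^*$ ($X^{**}$ is identified with $X$), and $X_+\subset X$ is a nonempty closed convex cone. $Y_+=\{p\in X^*: \langle p,x\rangle\ge 0\ \forall x\in X_+\}$; $\mathrm{int}$ is the interior in the norm topology. The budget map is $B(p)=\{x\in X_+:\langle p,x\rangle\le 1\}$ for $p\in Y_+$ and $B(p)=\emptyset$ for $p\in X^*\setminus Y_+$; $\mathrm{dom}\,B=\{p:B(p)\ne\emptyset\}=Y_+$. The utility function is $u:X\to\overline{\mathbb R}=[-\infty,+\infty]$ with $u(x)\in\mathbb R$ for all $x\in X_+$. The indirect utility function $v:X^*\to\overline{\mathbb R}$ is $v(p)=\sup\{u(x):x\in B(p)\}$ (with $\sup\emptyset=-\infty$), and the demand map is $D(p)=\{x\in B(p):u(x)=v(p)\}$ for $p\in Y_+$, $D(p)=\emptyset$ for $p\notin Y_+$. $\nabla u(\bar x)\in X^*$ is the Fréchet derivative. For a subset $\Omega$ of a Banach space $Z$, $x\in\Omega$ and $\varepsilon\ge 0$, let $\widehat N_\varepsilon(x;\Omega)=\{x^*\in Z^*:\limsup_{u\to x,\,u\in\Omega}\frac{\langle x^*,u-x\rangle}{\|u-x\|}\le\varepsilon\}$ and $\widehat N=\widehat N_0$. The limiting normal cone $N(\bar x;\Omega)$ is the set of weak* limits of sequences $x_k^*\in\widehat N_{\varepsilon_k}(x_k;\Omega)$ with $\varepsilon_k\downarrow0$, $x_k\to\bar x$, $x_k\in\Omega$; for the convex set $X_+$, $N(\bar x;X_+)$ is the normal cone of convex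 analysis. $\Omega$ is sequentially normally compact (SNC) at $\bar x\in\Omega$ if for all sequences $\varepsilon_k\downarrow 0$, $x_k\to\bar x$ with $x_k\in\Omega$, and $x_k^*\in\widehat N_{\varepsilon_k}(x_k;\Omega)$ converging weakly* to $0$, one has $\|x_k^*\|\to 0$. For $\varphi:Z\to\overline{\mathbb R}$ finite at $\bar z$, the Fréchet subdifferential is $\widehat\partial\varphi(\bar z)=\{z^*\in Z^*:(z^*,-1)\in\widehat N((\bar z,\varphi(\bar z));\mathrm{epi}\,\varphi)\}$, where $\mathrm{epi}\,\varphi=\{(z,\mu)\in Z\times\mathbb R:\mu\ge\varphi(z)\}$; it is $\emptyset$ if $\varphi(\bar z)$ is infinite. The map $D:\mathrm{dom}\,B\rightrightarrows X_+$ admits a local upper Lipschitzian selection at $(\bar p,\bar x)\in \mathrm{gph}\,D$ if there is $h:\mathrm{dom}\,B\to X_+$ with $h(\bar p)=\bar x$, $h(p)\in D(p)$ for all $p\in\mathrm{dom}\,B$ in a neighborhood of $\bar p$, and there are a neighborhood $U$ of $\bar p$ and $\ell>0$ with $\|h(p)-h(\bar p)\|\le\ell\|p-\bar p\|$ for all $p\in U\cap\mathrm{dom}\,B$. *)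

theory Defs
  imports "HOL-Analysis.Analysis"
begin

section \<open>Duality\<close>

lift_definition canonical_embedding ::
    "'z::real_normed_vector \<Rightarrow> ('z \<Rightarrow>\<^sub>L real) \<Rightarrow>\<^sub>L real" is "\<lambda>z p. blinfun_apply p z"
  by (rule blinfun.bounded_linear_left)

text \<open>A space is reflexive when \<^term>\<open>canonical_embedding\<close> is onto the bidual. Subgradients of
  functions on the dual space live in the bidual; they are compared with points of the space
  through this embedding.\<close>

definition weak_star_tendsto ::
    "(nat \<Rightarrow> ('z::real_normed_vector \<Rightarrow>\<^sub>L real)) \<Rightarrow> ('z \<Rightarrow>\<^sub>L real) \<Rightarrow> bool" where
  "weak_star_tendsto f g \<longleftrightarrow> (\<forall>z. (\<lambda>k. blinfun_apply (f k) z) \<longlonglongrightarrow> blinfun_apply g z)"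

section \<open>Normal cones and the Frechet subdifferential\<close>

text \<open>The filter \<^term>\<open>at x within \<Omega>\<close> excludes \<open>u = x\<close>, where the quotient is meaningless. At an
  isolated point of \<open>\<Omega>\<close> the upper limit is \<^term>\<open>- \<infinity> :: ereal\<close> and every functional is normal.\<close>

definition eps_normals ::
    "real \<Rightarrow> 'z::real_normed_vector \<Rightarrow> 'z set \<Rightarrow> ('z \<Rightarrow>\<^sub>L real) set" where
  "eps_normals \<epsilon> x \<Omega> = {x'. x \<in> \<Omega> \<and>
     Limsup (at x within \<Omega>) (\<lambda>u. ereal (blinfun_apply x' (u - x) / norm (u - x))) \<le> ereal \<epsilon>}"

abbreviation frechet_normal_cone ::
    "'z::real_normed_vector \<Rightarrow> 'z set \<Rightarrow> ('z \<Rightarrow>\<^sub>L real) set" where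
  "frechet_normal_cone \<equiv> eps_normals 0"

text \<open>Here \<open>\<epsilon>\<^sub>k\<close> decreases to \<open>0\<close> in the weak sense: it is nonincreasing with limit \<open>0\<close>,
  hence nonnegative, and the value \<open>0\<close> is allowed.\<close>

definition limiting_normal_cone ::
    "'z::real_normed_vector \<Rightarrow> 'z set \<Rightarrow> ('z \<Rightarrow>\<^sub>L real) set" where
  "limiting_normal_cone x \<Omega> = {x'. \<exists>\<epsilon> xs xs'. decseq \<epsilon> \<and> \<epsilon> \<longlonglongrightarrow> 0 \<and>
     (\<forall>k. xs k \<in> \<Omega>) \<and> xs \<longlonglongrightarrow> x \<and>
     (\<forall>k. xs' k \<in> eps_normals (\<epsilon> k) (xs k) \<Omega>) \<and> weak_star_tendsto xs' x'}"

definition SNC_at :: "'z::real_normed_vector set \<Rightarrow> 'z \<Rightarrow> bool" where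
  "SNC_at \<Omega> x \<longleftrightarrow> (\<forall>\<epsilon> xs xs'. decseq \<epsilon> \<longrightarrow> \<epsilon> \<longlonglongrightarrow> 0 \<longrightarrow>
     (\<forall>k. xs k \<in> \<Omega>) \<longrightarrow> xs \<longlonglongrightarrow> x \<longrightarrow>
     (\<forall>k. xs' k \<in> eps_normals (\<epsilon> k) (xs k) \<Omega>) \<longrightarrow> weak_star_tendsto xs' 0 \<longrightarrow>
     (\<lambda>k. norm (xs' k)) \<longlonglongrightarrow> 0)"

definition epi :: "('z \<Rightarrow> ereal) \<Rightarrow> ('z \<times> real) set" where
  "epi \<phi> = {(z, \<mu>). \<phi> z \<le> ereal \<mu>}"

text \<open>The functional \<open>(z', -1)\<close> on the product is \<open>(z, \<mu>) \<mapsto> z' z - \<mu>\<close>. The product type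
  carries the Euclidean norm; an equivalent norm would give the same Frechet normal cone.\<close>

definition frechet_subdifferential ::
    "('z::real_normed_vector \<Rightarrow> ereal) \<Rightarrow> 'z \<Rightarrow> ('z \<Rightarrow>\<^sub>L real) set" where
  "frechet_subdifferential \<phi> z = {z'. \<bar>\<phi> z\<bar> \<noteq> \<infinity> \<and>
     (z' o\<^sub>L fst_blinfun) - snd_blinfun \<in> frechet_normal_cone (z, real_of_ereal (\<phi> z)) (epi \<phi>)}"

text \<open>An extended-real-valued function is Frechet differentiable at a point only if it is finite
  around that point; the finiteness clause keeps the junk value of \<^const>\<open>real_of_ereal\<close> at
  infinity out of the difference quotient.\<close>

definition has_frechet_gradient ::
    "('z::real_normed_vector \<Rightarrow> ereal) \<Rightarrow> ('z \<Rightarrow>\<^sub>L real) \<Rightarrow> 'z \<Rightarrow> bool" where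
  "has_frechet_gradient \<phi> g z \<longleftrightarrow> (\<forall>\<^sub>F x in nhds z. \<bar>\<phi> x\<bar> \<noteq> \<infinity>) \<and>
     ((\<lambda>x. real_of_ereal (\<phi> x)) has_derivative blinfun_apply g) (at z)"

section \<open>The consumer problem\<close>

definition price_cone :: "'x::real_normed_vector set \<Rightarrow> ('x \<Rightarrow>\<^sub>L real) set" where
  "price_cone K = {p. \<forall>x\<in>K. 0 \<le> blinfun_apply p x}"

definition budget :: "'x::real_normed_vector set \<Rightarrow> ('x \<Rightarrow>\<^sub>L real) \<Rightarrow> 'x set" where
  "budget K p = (if p \<in> price_cone K then {x \<in> K. blinfun_apply p x \<le> 1} else {})"

definition budget_dom :: "'x::real_normed_vector set \<Rightarrow> ('x \<Rightarrow>\<^sub>L real) set" where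
  "budget_dom K = {p. budget K p \<noteq> {}}"

definition indirect_utility ::
    "'x::real_normed_vector set \<Rightarrow> ('x \<Rightarrow> ereal) \<Rightarrow> ('x \<Rightarrow>\<^sub>L real) \<Rightarrow> ereal" where
  "indirect_utility K u p = (SUP x\<in>budget K p. u x)"

definition demand ::
    "'x::real_normed_vector set \<Rightarrow> ('x \<Rightarrow> ereal) \<Rightarrow> ('x \<Rightarrow>\<^sub>L real) \<Rightarrow> 'x set" where
  "demand K u p =
     (if p \<in> price_cone K then {x \<in> budget K p. u x = indirect_utility K u p} else {})"

definition local_upper_lipschitz_selection ::
    "'x::real_normed_vector set \<Rightarrow> ('x \<Rightarrow> ereal) \<Rightarrow> ('x \<Rightarrow>\<^sub>L real) \<Rightarrow> 'x \<Rightarrow> bool" where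
  "local_upper_lipschitz_selection K u p\<^sub>0 x\<^sub>0 \<longleftrightarrow>
     x\<^sub>0 \<in> demand K u p\<^sub>0 \<and>
     (\<exists>h. h \<in> budget_dom K \<rightarrow> K \<and> h p\<^sub>0 = x\<^sub>0 \<and>
        (\<exists>V. open V \<and> p\<^sub>0 \<in> V \<and> (\<forall>p \<in> V \<inter> budget_dom K. h p \<in> demand K u p)) \<and>
        (\<exists>U l. open U \<and> p\<^sub>0 \<in> U \<and> l > 0 \<and>
           (\<forall>p \<in> U \<inter> budget_dom K. norm (h p - h p\<^sub>0) \<le> l * norm (p - p\<^sub>0))))"

end

theory Submission
  imports Defs
begin

text \<open>
  Write \<open>B\<close> for the budget map and \<open>v\<close> for the indirect utility. Everything rests on the chain
  \<open>u x \<le> v p\<close> for \<open>x \<in> B p\<close>, with equality at \<open>(p\<^sub>0, x\<^sub>0)\<close>. A Frechet subgradient \<open>w\<close> of \<open>- v\<close>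
  bounds \<open>v p\<close> from above by \<open>v p\<^sub>0 - w (p - p\<^sub>0)\<close>, a Frechet subgradient \<open>x'\<close> of \<open>u\<close> bounds \<open>u x\<close> from
  below by \<open>u x\<^sub>0 + x' (x - x\<^sub>0)\<close>, both up to errors of higher than first order. So for all
  \<open>(p, x)\<close> in the graph of \<open>B\<close> near \<open>(p\<^sub>0, x\<^sub>0)\<close> the number \<open>x' (x - x\<^sub>0) + w (p - p\<^sub>0)\<close> exceeds
  \<open>0\<close> by at most such an error.
  The assertions come from restricting this to suitable pairs in the graph.

  Keeping \<open>x = x\<^sub>0\<close> makes \<open>w\<close> nonpositive on every direction along which \<open>x\<^sub>0\<close> stays affordable
  (\<open>value_subgradient_normal_prices\<close>). As \<open>p\<^sub>0\<close> is interior to the price cone, these are all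
  directions if \<open>p\<^sub>0 x\<^sub>0 < 1\<close>, hence \<open>w = 0\<close>; if \<open>p\<^sub>0 x\<^sub>0 = 1\<close> they form the half-space of those
  \<open>d\<close> with \<open>d x\<^sub>0 \<le> 0\<close>, hence \<open>w\<close> is evaluation at a nonnegative multiple \<open>t x\<^sub>0\<close>. Keeping
  \<open>p = p\<^sub>0\<close> makes \<open>x'\<close> normal to \<open>B p\<^sub>0\<close>, which agrees with \<open>K\<close> near \<open>x\<^sub>0\<close> if
  \<open>p\<^sub>0 x\<^sub>0 < 1\<close>, so that \<open>x'\<close> is then normal to \<open>K\<close>.
  If \<open>p\<^sub>0 x\<^sub>0 = 1\<close>, a bundle \<open>x \<in> K\<close> near \<open>x\<^sub>0\<close> is affordable at the rescaled price
  \<open>p\<^sub>0 / p\<^sub>0 x\<close>, and the estimate along these pairs says that \<open>x' - t p\<^sub>0\<close> is normal to \<open>K\<close>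
  (\<open>multiplier_normal\<close>).

  For differentiable \<open>u\<close> with gradient \<open>g\<close>, evaluation at \<open>g x\<^sub>0 *\<^sub>R x\<^sub>0\<close> is a subgradient of \<open>- v\<close>: the
  selected demand \<open>h p\<close> becomes affordable at \<open>p\<^sub>0\<close> after division by \<open>1 - (p - p\<^sub>0) (h p)\<close>, so
  first-order optimality of \<open>x\<^sub>0\<close> bounds \<open>g (h p)\<close>, and the Lipschitz estimate turns the errors into
  \<open>o (norm (p - p\<^sub>0))\<close>. If \<open>p\<^sub>0 x\<^sub>0 = 1\<close>, uniqueness holds because \<open>g - t p\<^sub>0\<close>, as a
  normal to a cone, vanishes at its base point \<open>x\<^sub>0\<close>, which forces \<open>t = g x\<^sub>0\<close>.
\<close>

section \<open>Frechet normals and subgradients as first-order estimates\<close>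

text \<open>The quotients are cleared of their denominators, and the base point, where the product form
  reads \<open>0 \<le> 0\<close>, is included again; this makes normality easy to compose with limits.\<close>

lemma frechet_normal_cone_iff:
  fixes x :: "'z::real_normed_vector"
  shows "x' \<in> frechet_normal_cone x \<Omega> \<longleftrightarrow>
    x \<in> \<Omega> \<and> (\<forall>e>0. \<forall>\<^sub>F y in nhds x. y \<in> \<Omega> \<longrightarrow> x' (y - x) \<le> e * norm (y - x))"
proof -
  have quot: "(\<forall>\<^sub>F y in at x within \<Omega>. x' (y - x) / norm (y - x) < e)
      \<Longrightarrow> (\<forall>\<^sub>F y in nhds x. y \<in> \<Omega> \<longrightarrow> x' (y - x) \<le> e * norm (y - x))" for e
    unfolding eventually_at_filter
    by (erule eventually_mono) (auto simp: divide_simps split: if_splits)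
  \<comment> \<open>Half of \<open>e\<close> leaves room for the strict inequality.\<close>
  have mult: "(\<forall>\<^sub>F y in nhds x. y \<in> \<Omega> \<longrightarrow> x' (y - x) \<le> e / 2 * norm (y - x))
      \<Longrightarrow> (\<forall>\<^sub>F y in at x within \<Omega>. x' (y - x) / norm (y - x) < e)" if "e > 0" for e
    unfolding eventually_at_filter
  proof (erule eventually_mono, intro impI)
    fix y assume y: "y \<in> \<Omega> \<longrightarrow> x' (y - x) \<le> e / 2 * norm (y - x)" "y \<noteq> x" "y \<in> \<Omega>"
    then have "x' (y - x) \<le> e / 2 * norm (y - x)" by simp
    also have "\<dots> < e * norm (y - x)" using that y by simp
    finally show "x' (y - x) / norm (y - x) < e" using y by (simp add: divide_simps)
  qed
  have "Limsup (at x within \<Omega>) (\<lambda>y. ereal (x' (y - x) / norm (y - x))) \<le> ereal 0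
      \<longleftrightarrow> (\<forall>e>0. \<forall>\<^sub>F y in at x within \<Omega>. x' (y - x) / norm (y - x) < e)" (is "?L \<longleftrightarrow> ?R")
  proof
    assume L: ?L
    show ?R
    proof (intro allI impI)
      fix e :: real assume "e > 0"
      then have "\<forall>\<^sub>F y in at x within \<Omega>. ereal (x' (y - x) / norm (y - x)) < ereal e"
        using L unfolding Limsup_le_iff by (metis ereal_less_eq(3) less_ereal.simps(1))
      then show "\<forall>\<^sub>F y in at x within \<Omega>. x' (y - x) / norm (y - x) < e" by simp
    qed
  next
    assume R: ?R
    show ?L
      unfolding Limsup_le_iff
    proof (intro allI impI)
      fix c :: ereal assume "ereal 0 < c"
      then obtain e where e: "0 < e" "ereal e \<le> c"
        by (cases c) (auto intro: that[of 1])
      from R e(1) have "\<forall>\<^sub>F y in at x within \<Omega>. x' (y - x) / norm (y - x) < e" by blast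
      then show "\<forall>\<^sub>F y in at x within \<Omega>. ereal (x' (y - x) / norm (y - x)) < c"
        by (rule eventually_mono) (use e(2) in \<open>metis less_ereal.simps(1) order_less_le_trans\<close>)
    qed
  qed
  also have "\<dots> \<longleftrightarrow> (\<forall>e>0. \<forall>\<^sub>F y in nhds x. y \<in> \<Omega> \<longrightarrow> x' (y - x) \<le> e * norm (y - x))"
    using quot mult by (meson half_gt_zero)
  finally show ?thesis by (simp add: eps_normals_def)
qed

lemma frechet_normal_imp_limiting_normal:
  assumes "x' \<in> frechet_normal_cone x \<Omega>"
  shows "x' \<in> limiting_normal_cone x \<Omega>"
  unfolding limiting_normal_cone_def
proof (rule CollectI, intro exI conjI)
  show "decseq (\<lambda>k::nat. 0::real)" by (simp add: decseq_def)
  show "\<forall>k::nat. x' \<in> eps_normals 0 x \<Omega>" "\<forall>k::nat. x \<in> \<Omega>"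
    using assms by (auto simp: eps_normals_def)
  show "weak_star_tendsto (\<lambda>k. x') x'" by (simp add: weak_star_tendsto_def)
qed auto

text \<open>Normality along the ray, divided by \<open>t\<close>, bounds \<open>x' d\<close> by arbitrarily small multiples of
  \<open>norm d\<close>.\<close>

lemma frechet_normal_feasible_direction:
  assumes "x' \<in> frechet_normal_cone x \<Omega>"
    and d: "\<forall>\<^sub>F t in at_right 0. x + t *\<^sub>R d \<in> \<Omega>"
  shows "blinfun_apply x' d \<le> 0"
proof (rule field_le_epsilon)
  fix e :: real assume "e > 0"
  define e' where "e' = e / (1 + norm d)"
  have pos: "1 + norm d > 0" by (simp add: add_pos_nonneg)
  have e': "e' > 0" "e' * norm d \<le> e"
    using \<open>e > 0\<close> pos by (simp_all add: e'_def divide_simps)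
  have "((\<lambda>t. x + t *\<^sub>R d) \<longlongrightarrow> x + 0 *\<^sub>R d) (at_right (0::real))"
    by (intro tendsto_intros)
  then have lim: "filterlim (\<lambda>t. x + t *\<^sub>R d) (nhds x) (at_right (0::real))" by simp
  have "\<forall>\<^sub>F y in nhds x. y \<in> \<Omega> \<longrightarrow> x' (y - x) \<le> e' * norm (y - x)"
    using assms(1) e' by (simp add: frechet_normal_cone_iff)
  from eventually_compose_filterlim[OF this lim] d
  have "\<forall>\<^sub>F t in at_right (0::real). x' (t *\<^sub>R d) \<le> e' * norm (t *\<^sub>R d)"
    by eventually_elim simp
  moreover have "\<forall>\<^sub>F t in at_right (0::real). t > 0" by (rule eventually_at_right_less)
  ultimately have "\<forall>\<^sub>F t in at_right (0::real). x' d \<le> e' * norm d"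
    by eventually_elim (simp add: blinfun.scaleR_right mult.left_commute)
  then have "x' d \<le> e' * norm d" by simp
  with e' show "x' d \<le> 0 + e" by simp
qed

lemma frechet_normal_convex:
  assumes "convex \<Omega>" and "x' \<in> frechet_normal_cone x \<Omega>" and "y \<in> \<Omega>"
  shows "blinfun_apply x' (y - x) \<le> 0"
proof (rule frechet_normal_feasible_direction[OF assms(2)])
  have x: "x \<in> \<Omega>" using assms(2) by (simp add: frechet_normal_cone_iff)
  have "\<forall>\<^sub>F t in at_right (0::real). t \<in> {0<..<1}"
    by (rule eventually_at_right_real) simp
  then show "\<forall>\<^sub>F t in at_right 0. x + t *\<^sub>R (y - x) \<in> \<Omega>"
  proof eventually_elim
    case (elim t)
    then have "(1 - t) *\<^sub>R x + t *\<^sub>R y \<in> \<Omega>"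
      using convexD_alt[OF assms(1) x assms(3), of t] by simp
    then show ?case by (simp add: algebra_simps)
  qed
qed

text \<open>The points \<open>2 x\<close> and \<open>0\<close> of the cone give the two signs.\<close>

lemma frechet_normal_convex_cone:
  assumes "convex_cone K" and "x' \<in> frechet_normal_cone x K"
  shows "blinfun_apply x' x = 0"
proof -
  have K: "convex K" "conic K" using assms(1) by (auto simp: convex_cone_def)
  have x: "x \<in> K" using assms(2) by (simp add: frechet_normal_cone_iff)
  have "x' ((2::real) *\<^sub>R x - x) \<le> 0" "x' ((0::real) *\<^sub>R x - x) \<le> 0"
    using x K by (auto intro!: frechet_normal_convex[OF K(1) assms(2)] conicD simp del: scaleR_zero_left)
  then show ?thesis by (simp add: scaleR_2 blinfun.minus_right)
qed

text \<open>The epigraph contains points far above the graph, but the normal inequality there is weaker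
  than at the graph. Conversely, if \<open>\<phi> y\<close> falls below the claimed bound, then the point of the
  epigraph at exactly the height of this bound is close to \<open>(z, \<phi> z)\<close>, however far below it
  \<open>\<phi> y\<close> may lie, and violates the normal inequality.\<close>

lemma frechet_subdifferential_iff:
  fixes z :: "'z::real_normed_vector"
  shows "z' \<in> frechet_subdifferential \<phi> z \<longleftrightarrow> \<bar>\<phi> z\<bar> \<noteq> \<infinity> \<and>
    (\<forall>e>0. \<forall>\<^sub>F y in nhds z.
       ereal (real_of_ereal (\<phi> z) + z' (y - z) - e * norm (y - z)) \<le> \<phi> y)"
proof (cases "\<bar>\<phi> z\<bar> = \<infinity>")
  case True
  then show ?thesis by (simp add: frechet_subdifferential_def)
next
  case False
  define r where "r = real_of_ereal (\<phi> z)"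
  have r: "\<phi> z = ereal r" using False by (simp add: r_def ereal_real')
  let ?n = "(z' o\<^sub>L fst_blinfun) - snd_blinfun :: ('z \<times> real) \<Rightarrow>\<^sub>L real"
  have n: "?n w = z' (fst w) - snd w" for w by (simp add: blinfun.diff_left)
  have "?n \<in> frechet_normal_cone (z, r) (epi \<phi>) \<longleftrightarrow>
      (\<forall>e>0. \<forall>\<^sub>F y in nhds z. ereal (r + z' (y - z) - e * norm (y - z)) \<le> \<phi> y)"
    (is "?N \<longleftrightarrow> ?S")
  proof
    assume ?N
    show ?S
    proof (intro allI impI)
      fix e :: real assume e: "e > 0"
      \<comment> \<open>\<open>C * norm (y - z)\<close> bounds the distance of the test point \<open>(y, m y)\<close> from \<open>(z, r)\<close>.\<close>
      define C where "C = 1 + norm z' + e"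
      define e' where "e' = e / (2 * C)"
      define m where "m y = r + z' (y - z) - e * norm (y - z)" for y
      have C: "C > 0" using e by (simp add: C_def add_nonneg_pos)
      have e': "e' > 0" "e' * C = e / 2" using e C by (simp_all add: e'_def)
      have "(m \<longlongrightarrow> r + z' (z - z) - e * norm (z - z)) (nhds z)"
        unfolding m_def by (intro tendsto_intros filterlim_ident)
      then have "((\<lambda>y. (y, m y)) \<longlongrightarrow> (z, r)) (nhds z)"
        by (intro tendsto_Pair filterlim_ident) simp
      moreover have "\<forall>\<^sub>F w in nhds (z, r).
          w \<in> epi \<phi> \<longrightarrow> ?n (w - (z, r)) \<le> e' * norm (w - (z, r))"
        using \<open>?N\<close> e' unfolding frechet_normal_cone_iff by blast
      ultimately have "\<forall>\<^sub>F y in nhds z.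
          (y, m y) \<in> epi \<phi> \<longrightarrow> ?n ((y, m y) - (z, r)) \<le> e' * norm ((y, m y) - (z, r))"
        using eventually_compose_filterlim by blast
      then show "\<forall>\<^sub>F y in nhds z. ereal (r + z' (y - z) - e * norm (y - z)) \<le> \<phi> y"
      proof (rule eventually_mono)
        fix y
        assume y: "(y, m y) \<in> epi \<phi> \<longrightarrow> ?n ((y, m y) - (z, r)) \<le> e' * norm ((y, m y) - (z, r))"
        show "ereal (r + z' (y - z) - e * norm (y - z)) \<le> \<phi> y"
        proof (rule ccontr)
          assume "\<not> ?thesis"
          then have below: "\<phi> y < ereal (m y)" by (simp add: m_def)
          then have "y \<noteq> z" using r by (auto simp: m_def)
          have "?n ((y, m y) - (z, r)) \<le> e' * norm ((y, m y) - (z, r))"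
            using y below by (simp add: epi_def)
          then have "e * norm (y - z) \<le> e' * norm (y - z, m y - r)"
            by (simp add: n m_def)
          also have "\<dots> \<le> e' * (norm (y - z) + norm (m y - r))"
            using e' by (intro mult_left_mono norm_Pair_le) auto
          also have "\<dots> \<le> e' * (C * norm (y - z))"
          proof (intro mult_left_mono)
            have "norm (m y - r) \<le> norm z' * norm (y - z) + e * norm (y - z)"
              using norm_blinfun[of z' "y - z"] mult_nonneg_nonneg[OF less_imp_le[OF e] norm_ge_zero[of "y - z"]]
              unfolding m_def real_norm_def by linarith
            then show "norm (y - z) + norm (m y - r) \<le> C * norm (y - z)"
              by (simp add: C_def algebra_simps)
          qed (use e' in simp)
          also have "\<dots> = e / 2 * norm (y - z)" using e' by (simp flip: mult.assoc)
          finally show False using e \<open>y \<noteq> z\<close> by simp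
        qed
      qed
    qed
  next
    assume S: ?S
    show ?N
      unfolding frechet_normal_cone_iff
    proof (intro conjI allI impI)
      show "(z, r) \<in> epi \<phi>" by (simp add: epi_def r)
      fix e :: real assume e: "e > 0"
      have "filterlim fst (nhds z) (nhds (z, r))"
        using filterlim_ident[of "nhds (z, r)"] by (auto dest: tendsto_fst)
      moreover have "\<forall>\<^sub>F y in nhds z. ereal (r + z' (y - z) - e * norm (y - z)) \<le> \<phi> y"
        using S e by blast
      ultimately have "\<forall>\<^sub>F w in nhds (z, r).
          ereal (r + z' (fst w - z) - e * norm (fst w - z)) \<le> \<phi> (fst w)"
        using eventually_compose_filterlim by blast
      then show "\<forall>\<^sub>F w in nhds (z, r).
          w \<in> epi \<phi> \<longrightarrow> ?n (w - (z, r)) \<le> e * norm (w - (z, r))"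
      proof (rule eventually_mono, intro impI)
        fix w
        assume w: "ereal (r + z' (fst w - z) - e * norm (fst w - z)) \<le> \<phi> (fst w)" "w \<in> epi \<phi>"
        then have "ereal (r + z' (fst w - z) - e * norm (fst w - z)) \<le> ereal (snd w)"
          unfolding epi_def case_prod_unfold mem_Collect_eq by (rule order_trans)
        then have "z' (fst w - z) - (snd w - r) \<le> e * norm (fst w - z)" by simp
        also have "\<dots> \<le> e * norm (w - (z, r))"
          using e norm_fst_le[of "fst w - z" "snd w - r"]
          by (intro mult_left_mono) (auto simp: minus_prod_def)
        finally show "?n (w - (z, r)) \<le> e * norm (w - (z, r))" by (simp add: n)
      qed
    qed
  qed
  then show ?thesis using False by (simp add: frechet_subdifferential_def r_def)
qed

lemma frechet_gradient_estimate:
  assumes "has_frechet_gradient \<phi> g z" "e > 0"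
  shows "\<forall>\<^sub>F y in nhds z. \<bar>\<phi> y\<bar> \<noteq> \<infinity> \<and>
    \<bar>real_of_ereal (\<phi> y) - real_of_ereal (\<phi> z) - g (y - z)\<bar> \<le> e * norm (y - z)"
proof -
  have "((\<lambda>y. real_of_ereal (\<phi> y)) has_derivative g) (at z)"
    using assms(1) by (simp add: has_frechet_gradient_def)
  then obtain d where d: "d > 0" "\<And>y. norm (y - z) < d \<Longrightarrow>
      norm (real_of_ereal (\<phi> y) - real_of_ereal (\<phi> z) - g (y - z)) \<le> e * norm (y - z)"
    using assms(2) unfolding has_derivative_at_alt by blast
  have "\<forall>\<^sub>F y in nhds z.
      \<bar>real_of_ereal (\<phi> y) - real_of_ereal (\<phi> z) - g (y - z)\<bar> \<le> e * norm (y - z)"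
    unfolding eventually_nhds_metric using d by (auto simp: dist_norm)
  moreover have "\<forall>\<^sub>F y in nhds z. \<bar>\<phi> y\<bar> \<noteq> \<infinity>"
    using assms(1) by (simp add: has_frechet_gradient_def)
  ultimately show ?thesis by eventually_elim simp
qed

lemma frechet_gradient_in_subdifferential:
  assumes "has_frechet_gradient \<phi> g z"
  shows "g \<in> frechet_subdifferential \<phi> z"
  unfolding frechet_subdifferential_iff
proof (intro conjI allI impI)
  show "\<bar>\<phi> z\<bar> \<noteq> \<infinity>"
    using assms by (auto simp: has_frechet_gradient_def dest: eventually_nhds_x_imp_x)
  fix e :: real assume "e > 0"
  from frechet_gradient_estimate[OF assms this]
  show "\<forall>\<^sub>F y in nhds z. ereal (real_of_ereal (\<phi> z) + g (y - z) - e * norm (y - z)) \<le> \<phi> y"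
    by eventually_elim (auto simp: ereal_le_real_iff abs_le_iff)
qed

section \<open>First-order conditions for the consumer problem\<close>

lemma demandD:
  assumes "x \<in> demand K u p"
  shows "p \<in> price_cone K" "x \<in> budget K p" "x \<in> K" "p x \<le> 1" "indirect_utility K u p = u x"
  using assms by (auto simp: demand_def budget_def split: if_splits)

lemma utility_le_indirect_utility:
  "x \<in> budget K p \<Longrightarrow> u x \<le> indirect_utility K u p"
  by (simp add: indirect_utility_def SUP_upper)

lemma convex_budget: "convex K \<Longrightarrow> convex (budget K p)"
  by (auto simp: budget_def convex_alt blinfun.add_right blinfun.scaleR_right intro: convex_bound_le)

lemma value_subgradient_estimate:
  assumes "x\<^sub>0 \<in> demand K u p\<^sub>0"
    and "w \<in> frechet_subdifferential (\<lambda>p. - indirect_utility K u p) p\<^sub>0" and "e > 0"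
  shows "\<forall>\<^sub>F p in nhds p\<^sub>0. \<forall>x\<in>budget K p.
    u x \<le> ereal (real_of_ereal (u x\<^sub>0) - w (p - p\<^sub>0) + e * norm (p - p\<^sub>0))"
proof -
  have "\<forall>\<^sub>F p in nhds p\<^sub>0.
      ereal (real_of_ereal (- u x\<^sub>0) + w (p - p\<^sub>0) - e * norm (p - p\<^sub>0)) \<le> - indirect_utility K u p"
    using assms unfolding frechet_subdifferential_iff demandD(5)[OF assms(1)] by blast
  then show ?thesis
  proof eventually_elim
    case (elim p)
    then have "indirect_utility K u p
        \<le> ereal (real_of_ereal (u x\<^sub>0) - w (p - p\<^sub>0) + e * norm (p - p\<^sub>0))"
      by (cases "indirect_utility K u p"; cases "u x\<^sub>0") (auto simp: algebra_simps)
    then show ?case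
      using utility_le_indirect_utility order_trans by blast
  qed
qed

text \<open>As long as \<open>x\<^sub>0\<close> stays affordable, the indirect utility cannot fall below \<open>u x\<^sub>0\<close>.\<close>

lemma value_subgradient_normal_prices:
  assumes x0: "x\<^sub>0 \<in> demand K u p\<^sub>0" and fin: "\<bar>u x\<^sub>0\<bar> \<noteq> \<infinity>"
    and w: "w \<in> frechet_subdifferential (\<lambda>p. - indirect_utility K u p) p\<^sub>0"
  shows "w \<in> frechet_normal_cone p\<^sub>0 {p. x\<^sub>0 \<in> budget K p}"
  unfolding frechet_normal_cone_iff
proof (intro conjI allI impI)
  show "p\<^sub>0 \<in> {p. x\<^sub>0 \<in> budget K p}" using demandD[OF x0] by simp
  fix e :: real assume "e > 0"
  from value_subgradient_estimate[OF x0 w this]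
  show "\<forall>\<^sub>F p in nhds p\<^sub>0. p \<in> {p. x\<^sub>0 \<in> budget K p} \<longrightarrow> w (p - p\<^sub>0) \<le> e * norm (p - p\<^sub>0)"
    by eventually_elim (use fin in \<open>cases "u x\<^sub>0"; force\<close>)
qed

lemma utility_subgradient_normal_budget:
  assumes x0: "x\<^sub>0 \<in> demand K u p\<^sub>0" and x': "x' \<in> frechet_subdifferential u x\<^sub>0"
  shows "x' \<in> frechet_normal_cone x\<^sub>0 (budget K p\<^sub>0)"
  unfolding frechet_normal_cone_iff
proof (intro conjI allI impI)
  show "x\<^sub>0 \<in> budget K p\<^sub>0" using demandD[OF x0] by simp
  fix e :: real assume "e > 0"
  then have "\<forall>\<^sub>F x in nhds x\<^sub>0.
      ereal (real_of_ereal (u x\<^sub>0) + x' (x - x\<^sub>0) - e * norm (x - x\<^sub>0)) \<le> u x"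
    using x' by (simp add: frechet_subdifferential_iff)
  then show "\<forall>\<^sub>F x in nhds x\<^sub>0. x \<in> budget K p\<^sub>0 \<longrightarrow> x' (x - x\<^sub>0) \<le> e * norm (x - x\<^sub>0)"
  proof eventually_elim
    case (elim x)
    show ?case
    proof
      assume "x \<in> budget K p\<^sub>0"
      with elim have "ereal (real_of_ereal (u x\<^sub>0) + x' (x - x\<^sub>0) - e * norm (x - x\<^sub>0)) \<le> u x\<^sub>0"
        using utility_le_indirect_utility[of x K p\<^sub>0 u] demandD(5)[OF x0] order_trans by metis
      moreover have "\<bar>u x\<^sub>0\<bar> \<noteq> \<infinity>" using x' by (simp add: frechet_subdifferential_iff)
      ultimately show "x' (x - x\<^sub>0) \<le> e * norm (x - x\<^sub>0)" by (cases "u x\<^sub>0") auto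
    qed
  qed
qed

text \<open>A slack budget constraint stays slack near \<open>x\<^sub>0\<close>, so it does not affect normals there.\<close>

lemma frechet_normal_slack_budget:
  assumes "x' \<in> frechet_normal_cone x\<^sub>0 (budget K p\<^sub>0)" and slack: "p\<^sub>0 x\<^sub>0 < 1"
  shows "x' \<in> frechet_normal_cone x\<^sub>0 K"
proof -
  have x0: "x\<^sub>0 \<in> budget K p\<^sub>0" using assms(1) by (simp add: frechet_normal_cone_iff)
  then have p0: "p\<^sub>0 \<in> price_cone K" and "x\<^sub>0 \<in> K" by (auto simp: budget_def split: if_splits)
  have "(blinfun_apply p\<^sub>0 \<longlongrightarrow> p\<^sub>0 x\<^sub>0) (nhds x\<^sub>0)"
    by (intro tendsto_intros filterlim_ident)
  then have near: "\<forall>\<^sub>F x in nhds x\<^sub>0. p\<^sub>0 x < 1"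
    using slack by (rule order_tendstoD)
  have "\<forall>\<^sub>F x in nhds x\<^sub>0. x \<in> K \<longrightarrow> x' (x - x\<^sub>0) \<le> e * norm (x - x\<^sub>0)" if "e > 0" for e
  proof -
    have "\<forall>\<^sub>F x in nhds x\<^sub>0. x \<in> budget K p\<^sub>0 \<longrightarrow> x' (x - x\<^sub>0) \<le> e * norm (x - x\<^sub>0)"
      using assms(1) that by (simp add: frechet_normal_cone_iff)
    with near show ?thesis by eventually_elim (use p0 in \<open>simp add: budget_def\<close>)
  qed
  then show ?thesis using \<open>x\<^sub>0 \<in> K\<close> by (simp add: frechet_normal_cone_iff)
qed

section \<open>Shape of the subgradients of the negative indirect utility\<close>

lemma eventually_price_cone_direction:
  assumes "p\<^sub>0 \<in> interior (price_cone K)"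
  shows "\<forall>\<^sub>F t in at_right (0::real). p\<^sub>0 + t *\<^sub>R d \<in> price_cone K"
proof -
  have "((\<lambda>t. p\<^sub>0 + t *\<^sub>R d) \<longlongrightarrow> p\<^sub>0 + 0 *\<^sub>R d) (at_right (0::real))"
    by (intro tendsto_intros)
  moreover have "\<forall>\<^sub>F p in nhds (p\<^sub>0 + 0 *\<^sub>R d). p \<in> price_cone K"
    using assms by (auto simp: eventually_nhds interior_def)
  ultimately show ?thesis using eventually_compose_filterlim by blast
qed

text \<open>If the constraint is slack, then \<open>x\<^sub>0\<close> stays affordable for all small price changes, so \<open>w\<close> is
  nonpositive on \<open>d\<close> and on \<open>- d\<close>.\<close>

lemma value_subgradient_slack:
  assumes x0: "x\<^sub>0 \<in> demand K u p\<^sub>0" and fin: "\<bar>u x\<^sub>0\<bar> \<noteq> \<infinity>"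
    and w: "w \<in> frechet_subdifferential (\<lambda>p. - indirect_utility K u p) p\<^sub>0"
    and int: "p\<^sub>0 \<in> interior (price_cone K)" and slack: "p\<^sub>0 x\<^sub>0 < 1"
  shows "w = 0"
proof -
  have le: "w d \<le> 0" for d
  proof (rule frechet_normal_feasible_direction[OF value_subgradient_normal_prices[OF x0 fin w]])
    have "((\<lambda>t. (p\<^sub>0 + t *\<^sub>R d) x\<^sub>0) \<longlongrightarrow> (p\<^sub>0 + 0 *\<^sub>R d) x\<^sub>0) (at_right (0::real))"
      by (intro tendsto_intros)
    then have "\<forall>\<^sub>F t in at_right (0::real). (p\<^sub>0 + t *\<^sub>R d) x\<^sub>0 < 1"
      using slack by (intro order_tendstoD) auto
    with eventually_price_cone_direction[OF int, of d]
    show "\<forall>\<^sub>F t in at_right 0. p\<^sub>0 + t *\<^sub>R d \<in> {p. x\<^sub>0 \<in> budget K p}"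
      by eventually_elim (use demandD[OF x0] in \<open>simp add: budget_def\<close>)
  qed
  show ?thesis
  proof (rule blinfun_eqI)
    show "w d = blinfun_apply 0 d" for d using le[of d] le[of "- d"] by (simp add: blinfun.minus_right)
  qed
qed

text \<open>For a binding constraint, \<open>w\<close> is nonpositive on the half-space of directions \<open>d\<close> with
  \<open>d x\<^sub>0 \<le> 0\<close>. Since \<open>p\<^sub>0 x\<^sub>0 = 1\<close>, every \<open>d\<close> differs by the multiple \<open>d x\<^sub>0\<close> of \<open>p\<^sub>0\<close> from a
  direction in the boundary hyperplane, where \<open>w\<close> vanishes.\<close>

lemma value_subgradient_binding:
  assumes x0: "x\<^sub>0 \<in> demand K u p\<^sub>0" and fin: "\<bar>u x\<^sub>0\<bar> \<noteq> \<infinity>"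
    and w: "w \<in> frechet_subdifferential (\<lambda>p. - indirect_utility K u p) p\<^sub>0"
    and int: "p\<^sub>0 \<in> interior (price_cone K)" and binding: "p\<^sub>0 x\<^sub>0 = 1"
  obtains t where "t \<ge> 0" "w = canonical_embedding (t *\<^sub>R x\<^sub>0)"
proof (rule that[of "w p\<^sub>0"])
  have le: "w d \<le> 0" if "d x\<^sub>0 \<le> 0" for d :: "'a \<Rightarrow>\<^sub>L real"
  proof (rule frechet_normal_feasible_direction[OF value_subgradient_normal_prices[OF x0 fin w]])
    have "\<forall>\<^sub>F t in at_right (0::real). t > 0" by (rule eventually_at_right_less)
    with eventually_price_cone_direction[OF int, of d]
    show "\<forall>\<^sub>F t in at_right 0. p\<^sub>0 + t *\<^sub>R d \<in> {p. x\<^sub>0 \<in> budget K p}"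
    proof eventually_elim
      case (elim t)
      then have "t * d x\<^sub>0 \<le> 0" using that by (simp add: mult_nonneg_nonpos)
      then show ?case
        using elim demandD[OF x0] binding
        by (simp add: budget_def blinfun.add_left blinfun.scaleR_left)
    qed
  qed
  show "w p\<^sub>0 \<ge> 0" using le[of "- p\<^sub>0"] binding by (simp add: blinfun.minus_left blinfun.minus_right)
  show "w = canonical_embedding (w p\<^sub>0 *\<^sub>R x\<^sub>0)"
  proof (rule blinfun_eqI)
    fix d :: "'a \<Rightarrow>\<^sub>L real"
    have "w (d - d x\<^sub>0 *\<^sub>R p\<^sub>0) \<le> 0" "w (- (d - d x\<^sub>0 *\<^sub>R p\<^sub>0)) \<le> 0"
      using binding by (auto intro!: le simp: blinfun.diff_left blinfun.minus_left blinfun.scaleR_left)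
    then show "w d = canonical_embedding (w p\<^sub>0 *\<^sub>R x\<^sub>0) d"
      by (simp add: canonical_embedding.rep_eq blinfun.minus_right blinfun.diff_right
          blinfun.scaleR_right mult.commute)
  qed
qed

text \<open>With \<open>s = p\<^sub>0 (x - x\<^sub>0)\<close>, the price \<open>p\<^sub>0 / p\<^sub>0 x = p\<^sub>0 / (1 + s)\<close> makes \<open>x\<close> exactly affordable,
  and evaluation at \<open>t x\<^sub>0\<close> changes by \<open>t (1 / (1 + s) - 1) \<ge> - t s\<close>. The price moves by at most a
  constant times \<open>norm (x - x\<^sub>0)\<close>, so both error terms have the required order.\<close>

lemma multiplier_normal:
  assumes x0: "x\<^sub>0 \<in> demand K u p\<^sub>0" and t: "t \<ge> 0"
    and w: "canonical_embedding (t *\<^sub>R x\<^sub>0)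
      \<in> frechet_subdifferential (\<lambda>p. - indirect_utility K u p) p\<^sub>0"
    and x': "x' \<in> frechet_subdifferential u x\<^sub>0" and binding: "p\<^sub>0 x\<^sub>0 = 1"
  shows "x' - t *\<^sub>R p\<^sub>0 \<in> frechet_normal_cone x\<^sub>0 K"
  unfolding frechet_normal_cone_iff
proof (intro conjI allI impI)
  show "x\<^sub>0 \<in> K" using demandD[OF x0] by simp
  fix e :: real assume e: "e > 0"
  \<comment> \<open>\<open>C * norm (x - x\<^sub>0)\<close> bounds the joint displacement of the bundle and of its price \<open>q x\<close>.\<close>
  define C where "C = 1 + 2 * (norm p\<^sub>0)\<^sup>2"
  define e' where "e' = e / C"
  have "C > 0" by (simp add: C_def add_pos_nonneg)
  then have e': "e' > 0" "e' * C = e" using e by (simp_all add: e'_def)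
  define q where "q x = inverse (p\<^sub>0 x) *\<^sub>R p\<^sub>0" for x
  have "(q \<longlongrightarrow> inverse (p\<^sub>0 x\<^sub>0) *\<^sub>R p\<^sub>0) (nhds x\<^sub>0)"
    unfolding q_def using binding by (intro tendsto_intros filterlim_ident) auto
  then have "filterlim q (nhds p\<^sub>0) (nhds x\<^sub>0)" using binding by simp
  with value_subgradient_estimate[OF x0 w e'(1)]
  have "\<forall>\<^sub>F x in nhds x\<^sub>0. \<forall>y\<in>budget K (q x). u y \<le> ereal (real_of_ereal (u x\<^sub>0)
      - canonical_embedding (t *\<^sub>R x\<^sub>0) (q x - p\<^sub>0) + e' * norm (q x - p\<^sub>0))"
    by (rule eventually_compose_filterlim)
  moreover have "\<forall>\<^sub>F x in nhds x\<^sub>0.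
      ereal (real_of_ereal (u x\<^sub>0) + x' (x - x\<^sub>0) - e' * norm (x - x\<^sub>0)) \<le> u x"
    using x' e' by (simp add: frechet_subdifferential_iff)
  moreover have "\<forall>\<^sub>F x in nhds x\<^sub>0. 1 / 2 < p\<^sub>0 x"
  proof (rule order_tendstoD)
    show "(blinfun_apply p\<^sub>0 \<longlongrightarrow> p\<^sub>0 x\<^sub>0) (nhds x\<^sub>0)" by (intro tendsto_intros filterlim_ident)
  qed (use binding in simp)
  ultimately
  show "\<forall>\<^sub>F x in nhds x\<^sub>0. x \<in> K \<longrightarrow> (x' - t *\<^sub>R p\<^sub>0) (x - x\<^sub>0) \<le> e * norm (x - x\<^sub>0)"
  proof eventually_elim
    case (elim x)
    show ?case
    proof
      assume "x \<in> K"
      define s where "s = p\<^sub>0 (x - x\<^sub>0)"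
      have p0x: "p\<^sub>0 x = 1 + s" using binding by (simp add: s_def blinfun.diff_right)
      have s: "1 / 2 < 1 + s" using elim p0x by simp
      have diff: "q x - p\<^sub>0 = (- s / (1 + s)) *\<^sub>R p\<^sub>0"
      proof -
        have "q x - p\<^sub>0 = (inverse (1 + s) - 1) *\<^sub>R p\<^sub>0" by (simp add: q_def p0x scaleR_left_diff_distrib)
        also have "inverse (1 + s) - 1 = - s / (1 + s)" using s by (simp add: field_simps)
        finally show ?thesis .
      qed
      have "q x \<in> price_cone K" using demandD(1)[OF x0] s
        by (simp add: price_cone_def q_def p0x blinfun.scaleR_left)
      moreover have "q x x = 1" using s by (simp add: q_def p0x blinfun.scaleR_left)
      ultimately have "x \<in> budget K (q x)" using \<open>x \<in> K\<close> by (simp add: budget_def)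
      then have "ereal (real_of_ereal (u x\<^sub>0) + x' (x - x\<^sub>0) - e' * norm (x - x\<^sub>0))
          \<le> ereal (real_of_ereal (u x\<^sub>0)
            - canonical_embedding (t *\<^sub>R x\<^sub>0) (q x - p\<^sub>0) + e' * norm (q x - p\<^sub>0))"
        using elim order_trans by blast
      then have main: "x' (x - x\<^sub>0) + canonical_embedding (t *\<^sub>R x\<^sub>0) (q x - p\<^sub>0)
          \<le> e' * (norm (x - x\<^sub>0) + norm (q x - p\<^sub>0))"
        by (simp add: algebra_simps)
      have "canonical_embedding (t *\<^sub>R x\<^sub>0) (q x - p\<^sub>0) = t * (- s / (1 + s))"
        unfolding diff using binding
        by (simp add: canonical_embedding.rep_eq blinfun.scaleR_left blinfun.scaleR_right blinfun.minus_left)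
      moreover have "- s \<le> - s / (1 + s)"
      proof -
        have "- s / (1 + s) - (- s) = s\<^sup>2 / (1 + s)" using s by (simp add: field_simps power2_eq_square)
        also have "\<dots> \<ge> 0" using s by simp
        finally show ?thesis by simp
      qed
      ultimately have "- (t * s) \<le> canonical_embedding (t *\<^sub>R x\<^sub>0) (q x - p\<^sub>0)"
        using mult_left_mono[of "- s" "- s / (1 + s)" t] t by simp
      moreover have "norm (q x - p\<^sub>0) \<le> 2 * (norm p\<^sub>0)\<^sup>2 * norm (x - x\<^sub>0)"
      proof -
        have "norm (q x - p\<^sub>0) = \<bar>s\<bar> / (1 + s) * norm p\<^sub>0" using s by (simp add: diff)
        also have "\<dots> \<le> (norm p\<^sub>0 * norm (x - x\<^sub>0)) / (1 / 2) * norm p\<^sub>0"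
          using s norm_blinfun[of p\<^sub>0 "x - x\<^sub>0"]
          by (intro mult_right_mono frac_le) (auto simp: s_def)
        finally show ?thesis by (simp add: power2_eq_square algebra_simps)
      qed
      then have "e' * (norm (x - x\<^sub>0) + norm (q x - p\<^sub>0)) \<le> e' * (C * norm (x - x\<^sub>0))"
        using e' by (intro mult_left_mono) (auto simp: C_def algebra_simps)
      then have "e' * (norm (x - x\<^sub>0) + norm (q x - p\<^sub>0)) \<le> e * norm (x - x\<^sub>0)"
        using e' by (simp flip: mult.assoc)
      ultimately show "(x' - t *\<^sub>R p\<^sub>0) (x - x\<^sub>0) \<le> e * norm (x - x\<^sub>0)"
        using main by (simp add: blinfun.diff_left blinfun.scaleR_left flip: s_def)
    qed
  qed
qed

section \<open>A subgradient from a Lipschitzian demand selection\<close>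

text \<open>First-order optimality, \<open>g x \<le> g x\<^sub>0\<close> for \<open>x \<in> B p\<^sub>0\<close>, is made homogeneous by the cone: a bundle
  costing at most \<open>s\<close> at the prices \<open>p\<^sub>0\<close> has \<open>g x \<le> s g x\<^sub>0\<close>.\<close>

lemma gradient_scaled_optimality:
  assumes K: "convex_cone K" and x0: "x\<^sub>0 \<in> demand K u p\<^sub>0"
    and g: "g \<in> frechet_subdifferential u x\<^sub>0"
    and x: "x \<in> K" "p\<^sub>0 x \<le> s" "s > 0"
  shows "blinfun_apply g x \<le> s * g x\<^sub>0"
proof -
  have "inverse s *\<^sub>R x \<in> K" using K x by (auto simp: convex_cone_def intro: conicD)
  then have "inverse s *\<^sub>R x \<in> budget K p\<^sub>0"
    using x demandD(1)[OF x0] by (simp add: budget_def blinfun.scaleR_right field_simps)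
  then have "g (inverse s *\<^sub>R x - x\<^sub>0) \<le> 0"
    using K utility_subgradient_normal_budget[OF x0 g]
    by (intro frechet_normal_convex[OF convex_budget]) (auto simp: convex_cone_def)
  then show ?thesis using x by (simp add: blinfun.diff_right blinfun.scaleR_right field_simps)
qed

text \<open>The demand \<open>h p\<close> costs at most \<open>s = 1 - (p - p\<^sub>0) (h p)\<close> at the prices \<open>p\<^sub>0\<close>, so
  \<open>g (h p) \<le> s g x\<^sub>0\<close>. Here \<open>s\<close> differs from \<open>1 - (p - p\<^sub>0) x\<^sub>0\<close> by at most
  \<open>l (norm (p - p\<^sub>0))\<^sup>2\<close>, while \<open>u (h p)\<close> differs from its linearization by an error of smaller order
  than \<open>norm (h p - x\<^sub>0) \<le> l norm (p - p\<^sub>0)\<close>.\<close>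

lemma gradient_value_subgradient:
  assumes K: "convex_cone K" and int: "p\<^sub>0 \<in> interior (price_cone K)"
    and g: "has_frechet_gradient u g x\<^sub>0"
    and sel: "local_upper_lipschitz_selection K u p\<^sub>0 x\<^sub>0"
  shows "canonical_embedding (g x\<^sub>0 *\<^sub>R x\<^sub>0)
    \<in> frechet_subdifferential (\<lambda>p. - indirect_utility K u p) p\<^sub>0"
proof -
  from sel obtain h V U l where x0: "x\<^sub>0 \<in> demand K u p\<^sub>0" and h0: "h p\<^sub>0 = x\<^sub>0"
    and V: "open V" "p\<^sub>0 \<in> V" "\<forall>p \<in> V \<inter> budget_dom K. h p \<in> demand K u p"
    and U: "open U" "p\<^sub>0 \<in> U" "\<forall>p \<in> U \<inter> budget_dom K. norm (h p - h p\<^sub>0) \<le> l * norm (p - p\<^sub>0)"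
    and l: "l > 0"
    unfolding local_upper_lipschitz_selection_def by blast
  have grad: "g \<in> frechet_subdifferential u x\<^sub>0" by (rule frechet_gradient_in_subdifferential[OF g])
  have fin: "\<bar>u x\<^sub>0\<bar> \<noteq> \<infinity>" using grad by (simp add: frechet_subdifferential_iff)
  have zero: "0 \<in> K" using demandD(3)[OF x0] K
    by (auto simp: convex_cone_def conic_def) (metis order_refl scaleR_zero_left)
  have "\<forall>\<^sub>F p in nhds p\<^sub>0. p \<in> interior (price_cone K) \<and> p \<in> V \<and> p \<in> U"
    using int U V by (intro eventually_conj eventually_nhds_in_open) auto
  then have near: "\<forall>\<^sub>F p in nhds p\<^sub>0. h p \<in> demand K u p \<and> norm (h p - x\<^sub>0) \<le> l * norm (p - p\<^sub>0)"
  proof eventually_elim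
    case (elim p)
    then have "p \<in> price_cone K" using interior_subset by blast
    then have "p \<in> budget_dom K" using zero by (auto simp: budget_dom_def budget_def)
    then show ?case using elim U V h0 by auto
  qed
  have hlim: "(h \<longlongrightarrow> x\<^sub>0) (nhds p\<^sub>0)"
  proof (rule Lim_null[THEN iffD2], rule Lim_null_comparison)
    show "\<forall>\<^sub>F p in nhds p\<^sub>0. norm (h p - x\<^sub>0) \<le> l * norm (p - p\<^sub>0)"
      using near by eventually_elim simp
    have "((\<lambda>p. l * norm (p - p\<^sub>0)) \<longlongrightarrow> l * norm (p\<^sub>0 - p\<^sub>0)) (nhds p\<^sub>0)"
      by (intro tendsto_intros filterlim_ident)
    then show "((\<lambda>p. l * norm (p - p\<^sub>0)) \<longlongrightarrow> 0) (nhds p\<^sub>0)" by simp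
  qed
  show ?thesis
    unfolding frechet_subdifferential_iff demandD(5)[OF x0]
  proof (intro conjI allI impI)
    show "\<bar>- u x\<^sub>0\<bar> \<noteq> \<infinity>" using fin by simp
    fix e :: real assume e: "e > 0"
    \<comment> \<open>Half of \<open>e\<close> is spent on the linearization of \<open>u\<close>, half on the quadratic term.\<close>
    define e' where "e' = e / (2 * l)"
    have e': "e' > 0" "e' * l = e / 2" using e l by (simp_all add: e'_def)
    have "\<forall>\<^sub>F p in nhds p\<^sub>0. \<bar>u (h p)\<bar> \<noteq> \<infinity> \<and>
        \<bar>real_of_ereal (u (h p)) - real_of_ereal (u x\<^sub>0) - g (h p - x\<^sub>0)\<bar> \<le> e' * norm (h p - x\<^sub>0)"
      using frechet_gradient_estimate[OF g e'(1)] hlim by (rule eventually_compose_filterlim)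
    moreover have "\<forall>\<^sub>F p in nhds p\<^sub>0. 0 < 1 - (p - p\<^sub>0) (h p)"
    proof (rule order_tendstoD)
      show "((\<lambda>p. 1 - (p - p\<^sub>0) (h p)) \<longlongrightarrow> 1 - (p\<^sub>0 - p\<^sub>0) x\<^sub>0) (nhds p\<^sub>0)"
        by (intro tendsto_intros filterlim_ident hlim)
    qed simp
    moreover have "\<forall>\<^sub>F p in nhds p\<^sub>0. \<bar>g x\<^sub>0\<bar> * l * norm (p - p\<^sub>0) < e / 2"
    proof (rule order_tendstoD)
      show "((\<lambda>p. \<bar>g x\<^sub>0\<bar> * l * norm (p - p\<^sub>0)) \<longlongrightarrow> \<bar>g x\<^sub>0\<bar> * l * norm (p\<^sub>0 - p\<^sub>0)) (nhds p\<^sub>0)"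
        by (intro tendsto_intros filterlim_ident)
    qed (use e in simp)
    ultimately
    show "\<forall>\<^sub>F p in nhds p\<^sub>0. ereal (real_of_ereal (- u x\<^sub>0)
        + canonical_embedding (g x\<^sub>0 *\<^sub>R x\<^sub>0) (p - p\<^sub>0) - e * norm (p - p\<^sub>0))
        \<le> - indirect_utility K u p"
      using near
    proof eventually_elim
      case (elim p)
      define n where "n = norm (p - p\<^sub>0)"
      have hp: "h p \<in> demand K u p" and lip: "norm (h p - x\<^sub>0) \<le> l * n"
        using elim by (auto simp: n_def)
      have taylor: "\<bar>real_of_ereal (u (h p)) - real_of_ereal (u x\<^sub>0) - g (h p - x\<^sub>0)\<bar>
          \<le> e' * norm (h p - x\<^sub>0)"
        using elim by blast
      have "g (h p) \<le> (1 - (p - p\<^sub>0) (h p)) * g x\<^sub>0"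
        using demandD[OF hp] elim
        by (intro gradient_scaled_optimality[OF K x0 grad]) (auto simp: blinfun.diff_left)
      also have "\<dots> = g x\<^sub>0 - g x\<^sub>0 * (p - p\<^sub>0) x\<^sub>0 - g x\<^sub>0 * (p - p\<^sub>0) (h p - x\<^sub>0)"
        by (simp add: blinfun.diff_right algebra_simps)
      finally have lin: "g (h p - x\<^sub>0) \<le> - (g x\<^sub>0 * (p - p\<^sub>0) x\<^sub>0) - g x\<^sub>0 * (p - p\<^sub>0) (h p - x\<^sub>0)"
        by (simp add: blinfun.diff_right)
      have "\<bar>g x\<^sub>0 * (p - p\<^sub>0) (h p - x\<^sub>0)\<bar> \<le> \<bar>g x\<^sub>0\<bar> * (n * norm (h p - x\<^sub>0))"
        using norm_blinfun[of "p - p\<^sub>0" "h p - x\<^sub>0"] by (simp add: abs_mult n_def mult_left_mono)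
      also have "\<dots> \<le> \<bar>g x\<^sub>0\<bar> * (n * (l * n))"
        using lip by (intro mult_left_mono) (auto simp: n_def)
      also have "\<dots> = (\<bar>g x\<^sub>0\<bar> * l * n) * n" by simp
      also have "\<dots> \<le> e / 2 * n" using elim by (intro mult_right_mono) (auto simp: n_def)
      finally have quad: "\<bar>g x\<^sub>0 * (p - p\<^sub>0) (h p - x\<^sub>0)\<bar> \<le> e / 2 * n" .
      have "e' * norm (h p - x\<^sub>0) \<le> e' * (l * n)" using lip e' by (intro mult_left_mono) auto
      then have "e' * norm (h p - x\<^sub>0) \<le> e / 2 * n" using e' by (simp flip: mult.assoc)
      then have "real_of_ereal (u (h p)) \<le> real_of_ereal (u x\<^sub>0) - g x\<^sub>0 * (p - p\<^sub>0) x\<^sub>0 + e * n"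
        using taylor lin quad by linarith
      moreover have "canonical_embedding (g x\<^sub>0 *\<^sub>R x\<^sub>0) (p - p\<^sub>0) = g x\<^sub>0 * (p - p\<^sub>0) x\<^sub>0"
        by (simp add: canonical_embedding.rep_eq blinfun.scaleR_right)
      ultimately show ?case
        using elim fin unfolding demandD(5)[OF hp] n_def
        by (cases "u (h p)"; cases "u x\<^sub>0") auto
    qed
  qed
qed

section \<open>Subgradients of the negative indirect utility at an optimal bundle\<close>

theorem theorem4p3:
  fixes K :: "'x::banach set"
    and u :: "'x \<Rightarrow> ereal"
    and p\<^sub>0 :: "'x \<Rightarrow>\<^sub>L real"
    and x\<^sub>0 :: 'x
  assumes reflexive: "surj (canonical_embedding :: 'x \<Rightarrow> ('x \<Rightarrow>\<^sub>L real) \<Rightarrow>\<^sub>L real)"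
    and K: "closed K" "convex_cone K"
    and u_finite: "\<And>x. x \<in> K \<Longrightarrow> \<bar>u x\<bar> \<noteq> \<infinity>"
    and p0: "p\<^sub>0 \<in> interior (price_cone K)"
    and x0: "x\<^sub>0 \<in> demand K u p\<^sub>0 - {0}"
    and demand_nonempty: "demand K u p\<^sub>0 \<noteq> {}"
    and snc: "SNC_at K x\<^sub>0"
    and subdiff_nonempty: "frechet_subdifferential u x\<^sub>0 \<noteq> {}"
  shows
    "(blinfun_apply p\<^sub>0 x\<^sub>0 = 1 \<longrightarrow>
        frechet_subdifferential (\<lambda>p. - indirect_utility K u p) p\<^sub>0
          \<subseteq> (\<Inter>x' \<in> uminus ` frechet_subdifferential u x\<^sub>0.
               {canonical_embedding (t *\<^sub>R x\<^sub>0) | t::real.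
                  0 \<le> t \<and> x' + t *\<^sub>R p\<^sub>0 \<in> uminus ` limiting_normal_cone x\<^sub>0 K}))
   \<and> (blinfun_apply p\<^sub>0 x\<^sub>0 < 1 \<longrightarrow>
        frechet_subdifferential (\<lambda>p. - indirect_utility K u p) p\<^sub>0 \<subseteq> {0})
   \<and> (blinfun_apply p\<^sub>0 x\<^sub>0 < 1 \<longrightarrow>
        frechet_subdifferential u x\<^sub>0 - limiting_normal_cone x\<^sub>0 K \<noteq> {} \<longrightarrow>
        frechet_subdifferential (\<lambda>p. - indirect_utility K u p) p\<^sub>0 = {})
   \<and> (\<forall>g. has_frechet_gradient u g x\<^sub>0 \<longrightarrow>
        local_upper_lipschitz_selection K u p\<^sub>0 x\<^sub>0 \<longrightarrow>
        (blinfun_apply p\<^sub>0 x\<^sub>0 = 1 \<longrightarrow>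
          frechet_subdifferential (\<lambda>p. - indirect_utility K u p) p\<^sub>0
            = {canonical_embedding (blinfun_apply g x\<^sub>0 *\<^sub>R x\<^sub>0)}) \<and>
        (blinfun_apply p\<^sub>0 x\<^sub>0 < 1 \<longrightarrow>
          frechet_subdifferential (\<lambda>p. - indirect_utility K u p) p\<^sub>0 = {0}))"
proof -
  let ?S = "frechet_subdifferential (\<lambda>p. - indirect_utility K u p) p\<^sub>0"
  have x0': "x\<^sub>0 \<in> demand K u p\<^sub>0" using x0 by simp
  have fin: "\<bar>u x\<^sub>0\<bar> \<noteq> \<infinity>" by (rule u_finite[OF demandD(3)[OF x0']])
  have slack: "?S \<subseteq> {0}" if "p\<^sub>0 x\<^sub>0 < 1"
    using value_subgradient_slack[OF x0' fin _ p0 that] by blast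
  have tight: "?S \<subseteq> (\<Inter>x' \<in> uminus ` frechet_subdifferential u x\<^sub>0.
      {canonical_embedding (t *\<^sub>R x\<^sub>0) | t::real.
        0 \<le> t \<and> x' + t *\<^sub>R p\<^sub>0 \<in> uminus ` limiting_normal_cone x\<^sub>0 K})" if eq: "p\<^sub>0 x\<^sub>0 = 1"
  proof (rule subsetI, rule INT_I)
    fix w x' assume w: "w \<in> ?S" and "x' \<in> uminus ` frechet_subdifferential u x\<^sub>0"
    then obtain g where g: "g \<in> frechet_subdifferential u x\<^sub>0" "x' = - g" by blast
    obtain t where t: "t \<ge> 0" "w = canonical_embedding (t *\<^sub>R x\<^sub>0)"
      using value_subgradient_binding[OF x0' fin w p0 eq] .
    have "g - t *\<^sub>R p\<^sub>0 \<in> limiting_normal_cone x\<^sub>0 K"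
      using multiplier_normal[OF x0' t(1) _ g(1) eq] w t(2)
      by (simp add: frechet_normal_imp_limiting_normal)
    then have "x' + t *\<^sub>R p\<^sub>0 \<in> uminus ` limiting_normal_cone x\<^sub>0 K"
      by (rule rev_image_eqI) (simp add: g(2))
    with t show "w \<in> {canonical_embedding (t *\<^sub>R x\<^sub>0) | t::real.
        0 \<le> t \<and> x' + t *\<^sub>R p\<^sub>0 \<in> uminus ` limiting_normal_cone x\<^sub>0 K}" by blast
  qed
  have empty: "?S = {}" if "p\<^sub>0 x\<^sub>0 < 1"
    "frechet_subdifferential u x\<^sub>0 - limiting_normal_cone x\<^sub>0 K \<noteq> {}"
    using that utility_subgradient_normal_budget[OF x0'] frechet_normal_slack_budget
      frechet_normal_imp_limiting_normal by blast
  have smooth_slack: "?S = {0}" if "has_frechet_gradient u g x\<^sub>0"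
    "local_upper_lipschitz_selection K u p\<^sub>0 x\<^sub>0" "p\<^sub>0 x\<^sub>0 < 1" for g
    using gradient_value_subgradient[OF K(2) p0 that(1,2)] slack[OF that(3)] by auto
  have smooth_binding: "?S = {canonical_embedding (g x\<^sub>0 *\<^sub>R x\<^sub>0)}"
    if g: "has_frechet_gradient u g x\<^sub>0" and sel: "local_upper_lipschitz_selection K u p\<^sub>0 x\<^sub>0"
      and eq: "p\<^sub>0 x\<^sub>0 = 1" for g
  proof -
    have "w = canonical_embedding (g x\<^sub>0 *\<^sub>R x\<^sub>0)" if w: "w \<in> ?S" for w
    proof -
      obtain t where t: "t \<ge> 0" "w = canonical_embedding (t *\<^sub>R x\<^sub>0)"
        using value_subgradient_binding[OF x0' fin w p0 eq] .
      have "g - t *\<^sub>R p\<^sub>0 \<in> frechet_normal_cone x\<^sub>0 K"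
        using multiplier_normal[OF x0' t(1) _ frechet_gradient_in_subdifferential[OF g] eq] w t(2)
        by simp
      then have "(g - t *\<^sub>R p\<^sub>0) x\<^sub>0 = 0" by (rule frechet_normal_convex_cone[OF K(2)])
      then have "t = g x\<^sub>0" using eq by (simp add: blinfun.diff_left blinfun.scaleR_left)
      then show ?thesis by (simp add: t(2))
    qed
    then show ?thesis using gradient_value_subgradient[OF K(2) p0 g sel] by blast
  qed
  show ?thesis
    by (intro conjI allI impI) (fact slack tight empty smooth_slack smooth_binding)+
qed

end
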